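(* The Gaussian and mean curvatures of an admissible pseudo-isotropic parabolic revolution surface of i-type in $\mathbb{I}^3_{\mathrm{p}}$ are respectively $$K=\frac{(ac_1+bc_2)(f''z'-f'z'')}{B^2f'^3}+\frac{C^2}{B^2},\qquad H=\frac{a^2-b^2}{2B^2}\,\frac{f''z'-f'z''}{f'^3}-\frac{bc_2-ac_1}{2B^2},$$ where $C=c_1$ and $B=b$ if the generating curve is $\alpha(u)=(f(u),0,z(u))$ (spacelike), in which case the surface is $$Zh_3(u,t)=\left(at+f(u),\ bt,\ ct+\tfrac{ac_1+bc_2}{2}t^2+c_1t\,f(u)+z(u)\right),$$ and $C=c_2$ and $B=a$ if the generating curve is $\alpha(u)=(0,f(u),z(u))$ (timelike), in which case the surface is $$Wh_3(u,t)=\left(at,\ bt+f(u),\ ct+\tfrac{ac_1+bc_2}{2}t^2+c_2t\,f(u)+z(u)\right).$$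
   Context: Here $a,b,c,c_1,c_2\in\mathbb{R}$ are constants with $ac_1+bc_2\neq0$ (the defining condition of pseudo-parabolic rotations), generating curves are $C^2$, and primes denote $d/du$. The pseudo-isotropic space $\mathbb{I}^3_{\mathrm{p}}$ is $\mathbb{R}^3$ with the degenerate metric $\langle u,v\rangle_{pz}=u^1v^1-u^2v^2$. For a $C^2$ parameterized surface $\mathbf{x}(u^1,u^2)=(x^1,x^2,x^3)$ write $\mathbf{x}_i=\partial\mathbf{x}/\partial u^i$, $\mathbf{x}_{ij}=\partial^2\mathbf{x}/\partial u^i\partial u^j$, $x^i_k=\partial x^i/\partial u^k$, $X_{ij}=x^i_1x^j_2-x^j_1x^i_2$. The surface is admissible if $X_{12}\neq0$ (equivalently, the induced metric has rank 2). Put $g_{ij}=\langle\mathbf{x}_i,\mathbf{x}_j\rangle_{pz}$, $N_h=\left(\frac{X_{23}}{X_{12}},\frac{X_{13}}{X_{12}},1\right)$, $h_{ij}=\langle N_h,\mathbf{x}_{ij}\rangle_1$, where $\langle u,v\rangle_1=u^1v^1-u^2v^2+u^3v^3$. The Gaussian and mean curvatures are $$K=\frac{h_{11}h_{22}-h_{12}^2}{g_{11}g_{22}-g_{12}^2},\qquad H=\frac12\,\frac{g_{11}h_{22}-2g_{12}h_{12}+g_{22}h_{11}}{g_{11}g_{22}-g_{12}^2};$$ equivalently $K=\det L$, $H=\frac12\mathrm{tr}\,L$ with $L=-D\xi^{\mathrm p}$, $\xi^{\mathrm p}=\left(\alpha_1,\alpha_2,\frac12(1-\alpha_1^2+\alpha_2^2)\right)$,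 $\alpha_1=X_{23}/X_{12}$, $\alpha_2=X_{13}/X_{12}$. For the surfaces in the claim the coordinates are $(u^1,u^2)=(u,t)$. *)

theory Defs
  imports "HOL-Analysis.Analysis"
begin

definition C2_on :: "real set \<Rightarrow> (real \<Rightarrow> real) \<Rightarrow> bool" where
  "C2_on I f \<longleftrightarrow> (\<forall>u\<in>I. f differentiable (at u)) \<and> deriv f C1_differentiable_on I"

section \<open>Parameterized surfaces in pseudo-isotropic space\<close>

definition ip_pz :: "real^3 \<Rightarrow> real^3 \<Rightarrow> real" where
  "ip_pz v w = v$1 * w$1 - v$2 * w$2"

definition ip_1 :: "real^3 \<Rightarrow> real^3 \<Rightarrow> real" where
  "ip_1 v w = v$1 * w$1 - v$2 * w$2 + v$3 * w$3"

definition pd :: "2 \<Rightarrow> (real^2 \<Rightarrow> real^3) \<Rightarrow> real^2 \<Rightarrow> real^3" where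
  "pd i x p = vector_derivative (\<lambda>s. x (p + s *\<^sub>R axis i 1)) (at 0)"

definition X_minor :: "(real^2 \<Rightarrow> real^3) \<Rightarrow> 3 \<Rightarrow> 3 \<Rightarrow> real^2 \<Rightarrow> real" where
  "X_minor x i j p = pd 1 x p $ i * pd 2 x p $ j - pd 1 x p $ j * pd 2 x p $ i"

definition admissible_on :: "(real^2) set \<Rightarrow> (real^2 \<Rightarrow> real^3) \<Rightarrow> bool" where
  "admissible_on U x \<longleftrightarrow> (\<forall>p\<in>U. X_minor x 1 2 p \<noteq> 0)"

definition g_coeff :: "(real^2 \<Rightarrow> real^3) \<Rightarrow> 2 \<Rightarrow> 2 \<Rightarrow> real^2 \<Rightarrow> real" where
  "g_coeff x i j p = ip_pz (pd i x p) (pd j x p)"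

definition N_h :: "(real^2 \<Rightarrow> real^3) \<Rightarrow> real^2 \<Rightarrow> real^3" where
  "N_h x p = vector [X_minor x 2 3 p / X_minor x 1 2 p, X_minor x 1 3 p / X_minor x 1 2 p, 1]"

definition h_coeff :: "(real^2 \<Rightarrow> real^3) \<Rightarrow> 2 \<Rightarrow> 2 \<Rightarrow> real^2 \<Rightarrow> real" where
  "h_coeff x i j p = ip_1 (N_h x p) (pd i (pd j x) p)"

definition gauss_curvature :: "(real^2 \<Rightarrow> real^3) \<Rightarrow> real^2 \<Rightarrow> real" where
  "gauss_curvature x p =
     (h_coeff x 1 1 p * h_coeff x 2 2 p - (h_coeff x 1 2 p)^2) /
     (g_coeff x 1 1 p * g_coeff x 2 2 p - (g_coeff x 1 2 p)^2)"

definition mean_curvature :: "(real^2 \<Rightarrow> real^3) \<Rightarrow> real^2 \<Rightarrow> real" where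
  "mean_curvature x p = 1/2 *
     ((g_coeff x 1 1 p * h_coeff x 2 2 p - 2 * g_coeff x 1 2 p * h_coeff x 1 2 p
        + g_coeff x 2 2 p * h_coeff x 1 1 p) /
      (g_coeff x 1 1 p * g_coeff x 2 2 p - (g_coeff x 1 2 p)^2))"

section \<open>Parabolic revolution surfaces of i-type\<close>

text \<open>The parameter point is \<open>p = (u, t)\<close>.\<close>

definition Zh3 :: "real \<Rightarrow> real \<Rightarrow> real \<Rightarrow> real \<Rightarrow> real \<Rightarrow> (real \<Rightarrow> real) \<Rightarrow> (real \<Rightarrow> real)
    \<Rightarrow> real^2 \<Rightarrow> real^3" where
  "Zh3 a b c c1 c2 f z p = (let u = p$1; t = p$2 in
     vector [a * t + f u,
             b * t,
             c * t + (a * c1 + b * c2) / 2 * t^2 + c1 * t * f u + z u])"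

definition Wh3 :: "real \<Rightarrow> real \<Rightarrow> real \<Rightarrow> real \<Rightarrow> real \<Rightarrow> (real \<Rightarrow> real) \<Rightarrow> (real \<Rightarrow> real)
    \<Rightarrow> real^2 \<Rightarrow> real^3" where
  "Wh3 a b c c1 c2 f z p = (let u = p$1; t = p$2 in
     vector [a * t,
             b * t + f u,
             c * t + (a * c1 + b * c2) / 2 * t^2 + c2 * t * f u + z u])"

text \<open>The two surfaces are the orbits of the curves \<open>(f, 0, z)\<close> and \<open>(0, f, z)\<close> under a
  one-parameter group of pseudo-isotropic motions.\<close>

definition parabolic_rotation ::
    "real \<Rightarrow> real \<Rightarrow> real \<Rightarrow> real \<Rightarrow> real \<Rightarrow> real \<Rightarrow> real^3 \<Rightarrow> real^3" where
  "parabolic_rotation a b c c1 c2 t q =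
     vector [q$1 + a * t,
             q$2 + b * t,
             q$3 + c1 * t * q$1 + c2 * t * q$2 + c * t + (a * c1 + b * c2) / 2 * t^2]"

lemma parabolic_rotation_add:
  "parabolic_rotation a b c c1 c2 (s + t) q =
   parabolic_rotation a b c c1 c2 s (parabolic_rotation a b c c1 c2 t q)"
  by (simp add: parabolic_rotation_def vec_eq_iff forall_3 field_simps power2_eq_square)

lemma Zh3_eq_parabolic_rotation:
  "Zh3 a b c c1 c2 f z (vector [u, t]) =
   parabolic_rotation a b c c1 c2 t (vector [f u, 0, z u])"
  by (simp add: Zh3_def parabolic_rotation_def vec_eq_iff forall_3 Let_def algebra_simps)

lemma Wh3_eq_parabolic_rotation:
  "Wh3 a b c c1 c2 f z (vector [u, t]) =
   parabolic_rotation a b c c1 c2 t (vector [0, f u, z u])"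
  by (simp add: Wh3_def parabolic_rotation_def vec_eq_iff forall_3 Let_def algebra_simps)

end

theory Submission
  imports Defs
begin

text \<open>
  The isotropic Gaussian and mean curvatures are rational expressions in the partial derivatives
  of order one and two, so the content of the result is which terms cancel. Both surfaces are
  orbits, under the parabolic rotations, of a curve in an isotropic plane: the curve
  \<open>(e f, d f, z)\<close> with \<open>(e, d) = (1, 0)\<close> or \<open>(0, 1)\<close>. Treating a general direction
  \<open>(e, d)\<close> gives both cases at once and shows where the factors come from.

  With \<open>m = e c\<^sub>1 + d c\<^sub>2\<close>, \<open>k = a c\<^sub>1 + b c\<^sub>2\<close> and \<open>D = e b - d a\<close>, three facts
  carry the computation. The determinant of the metric is \<open>- D\<^sup>2 f'\<^sup>2\<close>, by the Lagrange identity
  for the Lorentzian product. The coefficients \<open>h\<^sub>1\<^sub>2 = m f'\<close> and \<open>h\<^sub>2\<^sub>2 = k\<close> only see the third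
  coordinate, because the first two coordinates of the surface are affine in \<open>t\<close> for fixed \<open>u\<close> and
  have zero mixed derivative. Finally \<open>h\<^sub>1\<^sub>1 = - (f'' z' - f' z'') / f'\<close>: the parameter \<open>t\<close> drops
  out, as it must, since the rotations are motions and preserve the curvatures along each orbit.
  Admissibility says \<open>D f' \<noteq> 0\<close>, which is exactly what makes the divisions meaningful.
\<close>

section \<open>Partial derivatives\<close>

lemma has_vector_derivative_vector3:
  fixes f g h :: "real \<Rightarrow> real"
  assumes "(f has_real_derivative f') F" "(g has_real_derivative g') F"
    "(h has_real_derivative h') F"
  shows "((\<lambda>s. vector [f s, g s, h s] :: real^3) has_vector_derivative vector [f', g', h']) F"
proof -
  have *: "vector [x, y, w] = x *\<^sub>R (vector [1, 0, 0] :: real^3) + y *\<^sub>R vector [0, 1, 0]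
      + w *\<^sub>R vector [0, 0, 1]" for x y w :: real
    by (simp add: vec_eq_iff forall_3)
  show ?thesis
    unfolding *[of "f _"] *[of f']
    by (intro has_vector_derivative_add
        bounded_linear.has_vector_derivative[OF bounded_linear_scaleR_left]
        assms[unfolded has_real_derivative_iff_has_vector_derivative])
qed

lemma pd_1_eqI:
  assumes "((\<lambda>r. x (vector [r, t])) has_vector_derivative D) (at u)"
  shows "pd 1 x (vector [u, t]) = D"
proof -
  have shift: "vector [u, t] + s *\<^sub>R axis 1 1 = (vector [u + s, t] :: real^2)" for s
    by (simp add: vec_eq_iff forall_2 axis_def)
  have "((\<lambda>s. u + s) has_vector_derivative 1) (at 0)"
    by (auto intro!: derivative_eq_intros)
  from vector_diff_chain_at[OF this, of "\<lambda>r. x (vector [r, t])" D] assms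
  show ?thesis
    by (simp add: pd_def shift o_def vector_derivative_at)
qed

lemma pd_2_eqI:
  assumes "((\<lambda>r. x (vector [u, r])) has_vector_derivative D) (at t)"
  shows "pd 2 x (vector [u, t]) = D"
proof -
  have shift: "vector [u, t] + s *\<^sub>R axis 2 1 = (vector [u, t + s] :: real^2)" for s
    by (simp add: vec_eq_iff forall_2 axis_def)
  have "((\<lambda>s. t + s) has_vector_derivative 1) (at 0)"
    by (auto intro!: derivative_eq_intros)
  from vector_diff_chain_at[OF this, of "\<lambda>r. x (vector [u, r])" D] assms
  show ?thesis
    by (simp add: pd_def shift o_def vector_derivative_at)
qed

lemma C2_on_has_real_derivative:
  assumes "C2_on I f" "u \<in> I"
  shows "(f has_real_derivative deriv f u) (at u)"
    and "(deriv f has_real_derivative deriv (deriv f) u) (at u)"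
proof -
  show "(f has_real_derivative deriv f u) (at u)"
    using assms by (auto simp: C2_on_def DERIV_deriv_iff_real_differentiable)
  show "(deriv f has_real_derivative deriv (deriv f) u) (at u)"
    using assms by (auto simp: C2_on_def C1_differentiable_on_eq DERIV_deriv_iff_real_differentiable)
qed

section \<open>Orbits of curves in isotropic planes\<close>

text \<open>The direction \<open>(e, d)\<close> of the base line of the plane is kept free, so that the spacelike
  choice \<open>(1, 0)\<close> and the timelike choice \<open>(0, 1)\<close> need only one computation.\<close>

definition planar_orbit :: "real \<Rightarrow> real \<Rightarrow> real \<Rightarrow> real \<Rightarrow> real \<Rightarrow> real \<Rightarrow> real \<Rightarrow>
    (real \<Rightarrow> real) \<Rightarrow> (real \<Rightarrow> real) \<Rightarrow> real^2 \<Rightarrow> real^3" where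
  "planar_orbit a b c c1 c2 e d f z p =
     parabolic_rotation a b c c1 c2 (p$2) (vector [e * f (p$1), d * f (p$1), z (p$1)])"

lemma planar_orbit_eq:
  "planar_orbit a b c c1 c2 e d f z (vector [u, t]) =
     vector [e * f u + a * t, d * f u + b * t,
       z u + (e * c1 + d * c2) * t * f u + c * t + (a * c1 + b * c2) / 2 * t^2]"
  by (simp add: planar_orbit_def parabolic_rotation_def vec_eq_iff forall_3 algebra_simps)

lemma Zh3_eq_planar_orbit: "Zh3 a b c c1 c2 f z = planar_orbit a b c c1 c2 1 0 f z"
  by (simp add: fun_eq_iff planar_orbit_def Zh3_def parabolic_rotation_def vec_eq_iff forall_3
      Let_def algebra_simps)

lemma Wh3_eq_planar_orbit: "Wh3 a b c c1 c2 f z = planar_orbit a b c c1 c2 0 1 f z"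
  by (simp add: fun_eq_iff planar_orbit_def Wh3_def parabolic_rotation_def vec_eq_iff forall_3
      Let_def algebra_simps)

lemma pd_1_planar_orbit:
  assumes "C2_on I f" "C2_on I z" "u \<in> I"
  shows "pd 1 (planar_orbit a b c c1 c2 e d f z) (vector [u, t]) =
    vector [e * deriv f u, d * deriv f u, deriv z u + (e * c1 + d * c2) * t * deriv f u]"
  using assms unfolding planar_orbit_eq
  by (intro pd_1_eqI)
    (auto simp: planar_orbit_eq intro!: has_vector_derivative_vector3 derivative_eq_intros
      C2_on_has_real_derivative)

lemma pd_2_planar_orbit:
  "pd 2 (planar_orbit a b c c1 c2 e d f z) (vector [u, t]) =
    vector [a, b, (e * c1 + d * c2) * f u + c + (a * c1 + b * c2) * t]"
  by (intro pd_2_eqI)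
    (auto simp: planar_orbit_eq intro!: has_vector_derivative_vector3 derivative_eq_intros)

text \<open>Differentiating the first partial derivative again in \<open>u\<close> uses its formula on a whole
  neighbourhood of \<open>u\<close>; this is where the openness of the parameter interval enters.\<close>

lemma pd_11_planar_orbit:
  assumes "open I" "C2_on I f" "C2_on I z" "u \<in> I"
  shows "pd 1 (pd 1 (planar_orbit a b c c1 c2 e d f z)) (vector [u, t]) =
    vector [e * deriv (deriv f) u, d * deriv (deriv f) u,
      deriv (deriv z) u + (e * c1 + d * c2) * t * deriv (deriv f) u]"
proof (rule pd_1_eqI)
  let ?v = "\<lambda>r. vector [e * deriv f r, d * deriv f r,
      deriv z r + (e * c1 + d * c2) * t * deriv f r] :: real^3"
  have "(?v has_vector_derivative vector [e * deriv (deriv f) u, d * deriv (deriv f) u,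
      deriv (deriv z) u + (e * c1 + d * c2) * t * deriv (deriv f) u]) (at u)"
    using assms by (auto intro!: has_vector_derivative_vector3 derivative_eq_intros
      C2_on_has_real_derivative)
  then show "((\<lambda>r. pd 1 (planar_orbit a b c c1 c2 e d f z) (vector [r, t])) has_vector_derivative
      vector [e * deriv (deriv f) u, d * deriv (deriv f) u,
      deriv (deriv z) u + (e * c1 + d * c2) * t * deriv (deriv f) u]) (at u)"
    by (rule has_vector_derivative_transform_within_open[OF _ assms(1) assms(4)])
      (simp add: pd_1_planar_orbit[OF assms(2,3)])
qed

lemma pd_12_planar_orbit:
  assumes "C2_on I f" "u \<in> I"
  shows "pd 1 (pd 2 (planar_orbit a b c c1 c2 e d f z)) (vector [u, t]) =
    vector [0, 0, (e * c1 + d * c2) * deriv f u]"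
  using assms
  by (intro pd_1_eqI)
    (auto simp: pd_2_planar_orbit intro!: has_vector_derivative_vector3 derivative_eq_intros
      C2_on_has_real_derivative)

lemma pd_22_planar_orbit:
  "pd 2 (pd 2 (planar_orbit a b c c1 c2 e d f z)) (vector [u, t]) =
    vector [0, 0, a * c1 + b * c2]"
  by (intro pd_2_eqI)
    (auto simp: pd_2_planar_orbit intro!: has_vector_derivative_vector3 derivative_eq_intros)

section \<open>Fundamental forms and curvatures\<close>

lemma X_minor_12_planar_orbit:
  assumes "C2_on I f" "C2_on I z" "u \<in> I"
  shows "X_minor (planar_orbit a b c c1 c2 e d f z) 1 2 (vector [u, t]) =
    (e * b - d * a) * deriv f u"
  using assms by (simp add: X_minor_def pd_1_planar_orbit pd_2_planar_orbit algebra_simps)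

lemma g_coeff_planar_orbit:
  assumes "C2_on I f" "C2_on I z" "u \<in> I"
  shows "g_coeff (planar_orbit a b c c1 c2 e d f z) 1 1 (vector [u, t]) =
      (e^2 - d^2) * (deriv f u)^2"
    and "g_coeff (planar_orbit a b c c1 c2 e d f z) 1 2 (vector [u, t]) =
      (e * a - d * b) * deriv f u"
    and "g_coeff (planar_orbit a b c c1 c2 e d f z) 2 2 (vector [u, t]) = a^2 - b^2"
  using assms
  by (simp_all add: g_coeff_def ip_pz_def pd_1_planar_orbit pd_2_planar_orbit algebra_simps
      power2_eq_square)

text \<open>The second derivative in \<open>u\<close> is \<open>f''/f'\<close> times the first one, up to a vertical vector with
  third coordinate \<open>z'' - z' f''/f'\<close>. Since \<open>N_h\<close> is \<open>ip_1\<close>-orthogonal to the tangent plane and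
  has third coordinate \<open>1\<close>, only that number survives in \<open>h\<^sub>1\<^sub>1\<close>. The other two second derivatives are
  themselves vertical.\<close>

lemma h_coeff_planar_orbit:
  assumes "open I" "C2_on I f" "C2_on I z" "u \<in> I"
    and adm: "e * b - d * a \<noteq> 0" "deriv f u \<noteq> 0"
  shows "h_coeff (planar_orbit a b c c1 c2 e d f z) 1 1 (vector [u, t]) =
      - (deriv (deriv f) u * deriv z u - deriv f u * deriv (deriv z) u) / deriv f u"
    and "h_coeff (planar_orbit a b c c1 c2 e d f z) 1 2 (vector [u, t]) =
      (e * c1 + d * c2) * deriv f u"
    and "h_coeff (planar_orbit a b c c1 c2 e d f z) 2 2 (vector [u, t]) = a * c1 + b * c2"
proof -
  let ?x = "planar_orbit a b c c1 c2 e d f z" and ?p = "vector [u, t] :: real^2"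
  let ?f1 = "deriv f u" and ?f2 = "deriv (deriv f) u"
  let ?z1 = "deriv z u" and ?z2 = "deriv (deriv z) u"
  note pds = pd_1_planar_orbit[OF assms(2-4)] pd_2_planar_orbit
    pd_11_planar_orbit[OF assms(1-4)] pd_12_planar_orbit[OF assms(2,4)] pd_22_planar_orbit
  have X: "X_minor ?x 1 2 ?p \<noteq> 0"
    using adm X_minor_12_planar_orbit[OF assms(2-4), of a b c c1 c2 e d t] by simp
  have orth: "ip_1 (N_h ?x ?p) (pd 1 ?x ?p) = 0"
    using X by (simp add: ip_1_def N_h_def field_simps) (simp add: X_minor_def algebra_simps)
  have "pd 1 (pd 1 ?x) ?p =
      (?f2 / ?f1) *\<^sub>R pd 1 ?x ?p + vector [0, 0, ?z2 - ?z1 * ?f2 / ?f1]"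
    using adm by (simp add: pds vec_eq_iff forall_3 field_simps)
  then have "ip_1 (N_h ?x ?p) (pd 1 (pd 1 ?x) ?p) =
      (?f2 / ?f1) * ip_1 (N_h ?x ?p) (pd 1 ?x ?p) + (?z2 - ?z1 * ?f2 / ?f1)"
    by (simp add: ip_1_def N_h_def algebra_simps)
  then show "h_coeff ?x 1 1 ?p = - (?f2 * ?z1 - ?f1 * ?z2) / ?f1"
    using adm orth by (simp add: h_coeff_def field_simps)
  show "h_coeff ?x 1 2 ?p = (e * c1 + d * c2) * ?f1" "h_coeff ?x 2 2 ?p = a * c1 + b * c2"
    by (simp_all add: h_coeff_def ip_1_def N_h_def pds)
qed

text \<open>With \<open>q(v) = v\<^sub>1\<^sup>2 - v\<^sub>2\<^sup>2\<close> this is Lagrange's identity for the Gram determinant of \<open>y (e, d)\<close> and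
  \<open>(a, b)\<close>; the left-hand side is the determinant of the metric when \<open>y = f'\<close>.\<close>

lemma lorentz_lagrange_identity:
  fixes a b e d y :: real
  shows "(e^2 - d^2) * y^2 * (a^2 - b^2) - ((e * a - d * b) * y)^2 =
    - ((e * b - d * a)^2 * y^2)"
  by algebra

theorem curvatures_planar_orbit:
  assumes "open I" "C2_on I f" "C2_on I z" "u \<in> I"
    and adm: "e * b - d * a \<noteq> 0" "deriv f u \<noteq> 0"
  defines "W \<equiv> deriv (deriv f) u * deriv z u - deriv f u * deriv (deriv z) u"
  shows "gauss_curvature (planar_orbit a b c c1 c2 e d f z) (vector [u, t]) =
      (a * c1 + b * c2) * W / ((e * b - d * a)^2 * (deriv f u)^3) +
      (e * c1 + d * c2)^2 / (e * b - d * a)^2" (is ?K)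
    and "mean_curvature (planar_orbit a b c c1 c2 e d f z) (vector [u, t]) =
      (a^2 - b^2) / (2 * (e * b - d * a)^2) * (W / (deriv f u)^3) -
      ((e^2 - d^2) * (a * c1 + b * c2) - 2 * (e * a - d * b) * (e * c1 + d * c2)) /
        (2 * (e * b - d * a)^2)" (is ?H)
proof -
  \<comment> \<open>Hiding the nonzero quantities behind variables keeps the denominators atomic.\<close>
  have frac: "(- W / y * k - (m * y)^2) / - (D^2 * y^2) = k * W / (D^2 * y^3) + m^2 / D^2"
    "1/2 * ((q * y^2 * k - 2 * (r * y) * (m * y) + s * (- W / y)) / - (D^2 * y^2)) =
      s / (2 * D^2) * (W / y^3) - (q * k - 2 * r * m) / (2 * D^2)"
    if "D \<noteq> 0" "y \<noteq> 0" for D y k m q r s :: real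
    using that by (simp_all add: field_simps power2_eq_square power3_eq_cube)
  show ?K ?H
    unfolding gauss_curvature_def mean_curvature_def h_coeff_planar_orbit[OF assms(1-6)]
      g_coeff_planar_orbit[OF assms(2-4)] lorentz_lagrange_identity W_def[symmetric]
    by (rule frac[OF adm])+
qed

section \<open>The two types of parabolic revolution surfaces\<close>

theorem proposition6p4:
  fixes a b c c1 c2 B C :: real and f z :: "real \<Rightarrow> real" and I :: "real set"
    and S :: "real^2 \<Rightarrow> real^3"
  assumes rot: "a * c1 + b * c2 \<noteq> 0"
    and I: "open I" "is_interval I"
    and C2: "C2_on I f" "C2_on I z"
    and surface: "(S = Zh3 a b c c1 c2 f z \<and> B = b \<and> C = c1) \<or>
                  (S = Wh3 a b c c1 c2 f z \<and> B = a \<and> C = c2)"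
    and admissible: "admissible_on {p. p$1 \<in> I} S"
  shows "\<forall>u\<in>I. \<forall>t.
    gauss_curvature S (vector [u, t]) =
      (a * c1 + b * c2) * (deriv (deriv f) u * deriv z u - deriv f u * deriv (deriv z) u)
        / (B^2 * (deriv f u)^3) + C^2 / B^2 \<and>
    mean_curvature S (vector [u, t]) =
      (a^2 - b^2) / (2 * B^2) *
        ((deriv (deriv f) u * deriv z u - deriv f u * deriv (deriv z) u) / (deriv f u)^3)
        - (b * c2 - a * c1) / (2 * B^2)"
proof (intro ballI allI)
  fix u t assume u: "u \<in> I"
  have X: "X_minor S 1 2 (vector [u, t]) \<noteq> 0"
    using admissible u by (simp add: admissible_on_def)
  note curv = curvatures_planar_orbit[OF I(1) C2 u]
  from surface show "gauss_curvature S (vector [u, t]) =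
      (a * c1 + b * c2) * (deriv (deriv f) u * deriv z u - deriv f u * deriv (deriv z) u)
        / (B^2 * (deriv f u)^3) + C^2 / B^2 \<and>
    mean_curvature S (vector [u, t]) =
      (a^2 - b^2) / (2 * B^2) *
        ((deriv (deriv f) u * deriv z u - deriv f u * deriv (deriv z) u) / (deriv f u)^3)
        - (b * c2 - a * c1) / (2 * B^2)"
  proof (elim disjE conjE)
    assume S: "S = Zh3 a b c c1 c2 f z" "B = b" "C = c1"
    have "b \<noteq> 0" "deriv f u \<noteq> 0"
      using X X_minor_12_planar_orbit[OF C2 u, of a b c c1 c2 1 0 t]
      by (auto simp: S Zh3_eq_planar_orbit)
    then show ?thesis
      using curv[of 1 b 0 a c c1 c2 t] by (simp add: S Zh3_eq_planar_orbit algebra_simps)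
  next
    assume S: "S = Wh3 a b c c1 c2 f z" "B = a" "C = c2"
    have "a \<noteq> 0" "deriv f u \<noteq> 0"
      using X X_minor_12_planar_orbit[OF C2 u, of a b c c1 c2 0 1 t]
      by (auto simp: S Wh3_eq_planar_orbit)
    then show ?thesis
      using curv[of 0 b 1 a c c1 c2 t] by (simp add: S Wh3_eq_planar_orbit algebra_simps)
  qed
qed

end
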